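(* Let $R$ be a commutative associative ring with $1$, let $a,b\in R$, and let $m$ be a positive integer. Let $C_{2m}(a,b)$ be the symmetric Toeplitz matrix of order $2m$ over $R$ with first row $(0,b,a,b,\dots,b)$; that is, the $(i,j)$ entry is $0$ if $i=j$, is $a$ if $|i-j|=2$, and is $b$ otherwise. With the convention $0^0=1$, $$ \mathrm{Hf}(C_{2m}(a,b))=\sum_{k=p}^m (a-b)^{m-k}\,b^k\,\frac{(2k)!}{k!\,2^k}\sum_{i=\max\left(0,\left\lceil \frac{m-3k}{2}\right\rceil\right)}^{\left\lfloor \frac{m-k}{2}\right\rfloor}\binom{2k+i}{m-k-i}\binom{m-k-i}{i}, $$ where $p=0$ when $m$ is even and $p=1$ when $m$ is odd.
   Context: For a symmetric matrix $A=(a_{ij})$ of even order $n$ over a commutative associative ring, the hafnian of $A$ is $$\mathrm{Hf}(A)=\sum_{(i_1i_2|\dots|i_{n-1}i_n)} a_{i_1i_2}\cdots a_{i_{n-1}i_n},$$ where the sum ranges over all unordered partitions of the set $\{1,2,\dots,n\}$ into unordered pairs $(i_1i_2),\dots,(i_{n-1}i_n)$. The numbers $\frac{(2k)!}{k!\,2^k}$ are integers; integers act on $R$ in the usual way (as integer multiples). The convention $0^0=1$ means $x^0=1$ for every $x\in R$, including $x=0$. *)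

theory Defs
  imports Complex_Main "HOL-Library.Disjoint_Sets" "Jordan_Normal_Form.Matrix"
begin

definition pair_partitions :: "nat set \<Rightarrow> nat set set set" where
  "pair_partitions X = {P. partition_on X P \<and> (\<forall>e\<in>P. card e = 2)}"

(* Intended for symmetric matrices of even order.  Each unordered pair e is read as
   (Min e, Max e); by symmetry the order is irrelevant.  Rows and columns of the
   library's matrices are numbered from 0. *)
definition hafnian :: "'a :: comm_ring_1 mat \<Rightarrow> 'a" where
  "hafnian A = (\<Sum>P\<in>pair_partitions {0..<dim_row A}. \<Prod>e\<in>P. A $$ (Min e, Max e))"

definition C_mat :: "nat \<Rightarrow> 'a :: comm_ring_1 \<Rightarrow> 'a \<Rightarrow> 'a mat" where
  "C_mat n a b = mat n n (\<lambda>(i, j).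
     if i = j then 0 else if \<bar>int i - int j\<bar> = 2 then a else b)"

end

theory Submission
  imports Defs
begin

text \<open>
Every off-diagonal entry is \<open>b\<close>, plus \<open>a - b\<close> at the pairs \<open>{i, i + 2}\<close>. Expanding the products,
each matching of \<open>r\<close> such pairs contributes \<open>(a - b)^r b^(m-r)\<close> once for each of the
\<open>(2k)! / (k! 2^k)\<close> ways to pair off the remaining \<open>2k = 2(m - r)\<close> vertices. Reading the vertices
from left to right, a matching by pairs \<open>{i, i + 2}\<close> is a tiling of the line by blocks of length 1
(an unmatched vertex), 3 (one pair around an unmatched vertex) and 4 (two interleaved pairs),
so matchings are counted by trinomial coefficients.
\<close>

section \<open>Counting partitions into pairs, with some pairs prescribed\<close>

lemma finite_pair_partitions: "finite X \<Longrightarrow> finite (pair_partitions X)"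
  by (rule finite_subset[OF _ finitely_many_partition_on[of X]]) (auto simp: pair_partitions_def)

lemma card_pair_partition:
  assumes "finite X" "P \<in> pair_partitions X"
  shows "2 * card P = card X"
proof -
  have P: "partition_on X P" and two: "\<And>e. e \<in> P \<Longrightarrow> card e = 2"
    using assms(2) by (auto simp: pair_partitions_def)
  have "card (\<Union>P) = sum card P"
    using partition_onD2[OF P] two
    by (intro card_Union_disjoint) (auto intro: card_ge_0_finite)
  then show ?thesis
    using partition_onD1[OF P] two by simp
qed

text \<open>The inverse map adds \<open>Q\<close> back. It undoes the removal because a block of a
  partition of \<open>X - \<Union>Q\<close> is nonempty and avoids every vertex of \<open>Q\<close>,
  so it cannot itself belong to \<open>Q\<close>.\<close>

lemma bij_betw_pair_partitions_superset:
  assumes Q: "disjoint Q" "\<And>e. e \<in> Q \<Longrightarrow> card e = 2" "\<Union>Q \<subseteq> X"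
  shows "bij_betw (\<lambda>P. P - Q) {P \<in> pair_partitions X. Q \<subseteq> P} (pair_partitions (X - \<Union>Q))"
proof (rule bij_betw_byWitness[where f' = "\<lambda>P. P \<union> Q"])
  have "P \<inter> Q = {}" if "P \<in> pair_partitions (X - \<Union>Q)" for P
  proof -
    from that have P: "\<Union>P = X - \<Union>Q" "{} \<notin> P"
      by (auto simp: pair_partitions_def partition_on_def)
    show ?thesis
    proof (rule ccontr)
      assume "P \<inter> Q \<noteq> {}"
      then obtain e where e: "e \<in> P" "e \<in> Q" by blast
      with P obtain x where "x \<in> e" by (metis all_not_in_conv)
      with e P(1) show False by blast
    qed
  qed
  then show "\<forall>P\<in>pair_partitions (X - \<Union>Q). P \<union> Q - Q = P"
    by blast
next
  show "(\<lambda>P. P - Q) ` {P \<in> pair_partitions X. Q \<subseteq> P} \<subseteq> pair_partitions (X - \<Union>Q)"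
  proof clarify
    fix P assume P: "P \<in> pair_partitions X" "Q \<subseteq> P"
    then have dis: "disjoint P" and U: "\<Union>P = X"
      by (auto simp: pair_partitions_def partition_on_def)
    have "\<Union>(P - Q) = X - \<Union>Q"
    proof
      show "\<Union>(P - Q) \<subseteq> X - \<Union>Q"
      proof
        fix x assume "x \<in> \<Union>(P - Q)"
        then obtain e where e: "e \<in> P" "e \<notin> Q" "x \<in> e" by blast
        have "x \<notin> f" if "f \<in> Q" for f
          using pairwiseD[OF dis, of e f] e that P(2) by (auto simp: disjnt_def)
        with e U show "x \<in> X - \<Union>Q" by blast
      qed
    qed (use U in blast)
    moreover have "disjoint (P - Q)"
      using dis by (rule pairwise_subset) blast
    ultimately show "P - Q \<in> pair_partitions (X - \<Union>Q)"
      using P by (auto simp: pair_partitions_def partition_on_def)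
  qed
next
  show "(\<lambda>P. P \<union> Q) ` pair_partitions (X - \<Union>Q) \<subseteq> {P \<in> pair_partitions X. Q \<subseteq> P}"
  proof clarify
    fix P assume P: "P \<in> pair_partitions (X - \<Union>Q)"
    then have dis: "disjoint P" and U: "\<Union>P = X - \<Union>Q" and ne: "{} \<notin> P"
      and two: "\<And>e. e \<in> P \<Longrightarrow> card e = 2"
      by (auto simp: pair_partitions_def partition_on_def)
    have "disjoint (P \<union> Q)"
      by (rule disjoint_union[OF dis Q(1)]) (use U in blast)
    moreover have "\<Union>(P \<union> Q) = X" using U Q(3) by blast
    moreover have "{} \<notin> Q" using Q(2) by fastforce
    ultimately show "P \<union> Q \<in> pair_partitions X \<and> Q \<subseteq> P \<union> Q"
      using two Q(2) ne by (auto simp: pair_partitions_def partition_on_def)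
  qed
qed auto

lemma card_pair_partitions_superset:
  assumes "disjoint Q" "\<And>e. e \<in> Q \<Longrightarrow> card e = 2" "\<Union>Q \<subseteq> X"
  shows "card {P \<in> pair_partitions X. Q \<subseteq> P} = card (pair_partitions (X - \<Union>Q))"
  using bij_betw_same_card[OF bij_betw_pair_partitions_superset[OF assms]] .

text \<open>Fix a vertex \<open>x\<close> and classify the partitions by the partner
  \<open>y\<close> of \<open>x\<close>: there are \<open>2 * k + 1\<close> choices of
  \<open>y\<close>, and each leaves \<open>2 * k\<close> vertices to pair off. The product form
  keeps division on the naturals out of the induction.\<close>

lemma card_pair_partitions_mult:
  assumes "finite X" "card X = 2 * k"
  shows "card (pair_partitions X) * (fact k * 2 ^ k) = fact (2 * k)"
  using assms
proof (induction k arbitrary: X)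
  case 0
  then have "pair_partitions X = {{}}"
    by (auto simp: pair_partitions_def partition_on_empty)
  then show ?case by simp
next
  case (Suc k)
  then obtain x where x: "x \<in> X" by fastforce
  define F where "F y = {P \<in> pair_partitions X. {{x, y}} \<subseteq> P}" for y
  have eq: "pair_partitions X = (\<Union>y\<in>X - {x}. F y)"
  proof
    show "pair_partitions X \<subseteq> (\<Union>y\<in>X - {x}. F y)"
    proof
      fix P assume P: "P \<in> pair_partitions X"
      then have U: "\<Union>P = X" by (auto simp: pair_partitions_def partition_on_def)
      with x obtain e where e: "e \<in> P" "x \<in> e" by blast
      with P have "card e = 2" by (auto simp: pair_partitions_def)
      with e obtain y where "e = {x, y}" "x \<noteq> y" by (auto simp: card_2_iff)
      with e P U show "P \<in> (\<Union>y\<in>X - {x}. F y)" by (auto simp: F_def)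
    qed
  qed (auto simp: F_def)
  have inter: "F y \<inter> F z = {}" if "y \<noteq> z" for y z
  proof -
    have False if "disjoint P" "{x, y} \<in> P" "{x, z} \<in> P" for P
      using pairwiseD[OF that] \<open>y \<noteq> z\<close> by (auto simp: doubleton_eq_iff disjnt_def)
    then show ?thesis by (auto simp: F_def pair_partitions_def partition_on_def)
  qed
  have cardF: "card (F y) * (fact k * 2 ^ k) = fact (2 * k)" if "y \<in> X - {x}" for y
  proof -
    have "card (F y) = card (pair_partitions (X - \<Union>{{x, y}}))"
      unfolding F_def by (rule card_pair_partitions_superset) (use that x in auto)
    moreover have "card (X - {x, y}) = 2 * k"
      using that x Suc.prems by (subst card_Diff_subset) auto
    ultimately show ?thesis
      using Suc.IH[of "X - {x, y}"] Suc.prems by simp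
  qed
  have "card (pair_partitions X) = (\<Sum>y\<in>X - {x}. card (F y))"
    unfolding eq using Suc.prems inter finite_pair_partitions[of X]
    by (intro card_UN_disjoint) (auto simp: F_def)
  then have "card (pair_partitions X) * (fact k * 2 ^ k) = (\<Sum>y\<in>X - {x}. fact (2 * k))"
    by (simp only: sum_distrib_right cardF cong: sum.cong)
  also have "\<dots> = (2 * k + 1) * fact (2 * k)"
    using Suc.prems x by simp
  finally have "card (pair_partitions X) * (fact k * 2 ^ k) = (2 * k + 1) * fact (2 * k)" .
  \<comment> \<open>The factor \<open>2 * k + 2\<close> completes both sides at once:
    \<open>(2 * k + 1) * fact (2 * k)\<close> becomes \<open>fact (2 * Suc k)\<close>, and
    \<open>fact k * 2 ^ k\<close> becomes \<open>fact (Suc k) * 2 ^ Suc k\<close>.\<close>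
  then have "(2 * k + 2) * (card (pair_partitions X) * (fact k * 2 ^ k))
      = (2 * k + 2) * ((2 * k + 1) * fact (2 * k))"
    by simp
  then show ?case by (simp add: algebra_simps)
qed

lemma card_pair_partitions:
  assumes "finite X" "card X = 2 * k"
  shows "card (pair_partitions X) = fact (2 * k) div (fact k * 2 ^ k)"
  using card_pair_partitions_mult[OF assms]
  by (metis fact_nonzero mult_eq_0_iff nonzero_mult_div_cancel_right power_not_zero zero_neq_numeral)

section \<open>Recurrence for matchings by pairs at distance 2\<close>

text \<open>A set \<open>S\<close> of indices encodes the set of pairs \<open>{i, i + 2}\<close> with \<open>i \<in> S\<close>, so on \<open>n\<close> vertices
  the relevant length is \<open>l = n - 2\<close>.\<close>
definition sparse_sets :: "nat \<Rightarrow> nat set set" where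
  "sparse_sets l = {S. S \<subseteq> {..<l} \<and> (\<forall>i\<in>S. i + 2 \<notin> S)}"

definition matching_count :: "nat \<Rightarrow> nat \<Rightarrow> nat" where
  "matching_count l r = card {S \<in> sparse_sets l. card S = r}"

lemma finite_sparse_sets: "finite (sparse_sets l)"
  by (rule finite_subset[of _ "Pow {..<l}"]) (auto simp: sparse_sets_def)

lemma finite_sparse: "S \<in> sparse_sets l \<Longrightarrow> finite S"
  by (auto simp: sparse_sets_def intro: finite_subset)

text \<open>The three parts correspond to a last block of length 1, 3 or 4. If \<open>l + 1\<close>
  is in \<open>S\<close> then \<open>l - 1\<close> is not; if \<open>l\<close> is in
  \<open>S\<close> as well, \<open>l - 2\<close> is excluded too. For small \<open>l\<close> the
  truncated subtraction gives the empty range, which is still correct.\<close>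

lemma sparse_sets_split:
  "sparse_sets (l + 2) = sparse_sets (l + 1) \<union>
     (insert (l + 1) ` sparse_sets (l - 1) \<union> (\<lambda>S. insert (l + 1) (insert l S)) ` sparse_sets (l - 2))"
  (is "?L = ?A \<union> (?B \<union> ?C)")
proof
  show "?L \<subseteq> ?A \<union> (?B \<union> ?C)"
  proof
    fix S assume S: "S \<in> ?L"
    show "S \<in> ?A \<union> (?B \<union> ?C)"
    proof (cases "l + 1 \<in> S")
      case False
      with S have "S \<in> ?A" by (auto simp: sparse_sets_def less_Suc_eq)
      then show ?thesis by blast
    next
      case top: True
      then have no: "l - 1 \<notin> S" if "l > 0"
        using S that by (auto simp: sparse_sets_def dest!: bspec[of S _ "l - 1"])
      show ?thesis
      proof (cases "l \<in> S")
        case False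
        have "S - {l + 1} \<subseteq> {..<l - 1}"
        proof
          fix i assume i: "i \<in> S - {l + 1}"
          then have "i < l + 2" using S by (auto simp: sparse_sets_def)
          moreover have "i \<noteq> l" using i False by auto
          moreover have "i \<noteq> l - 1" if "l > 0" using i no[OF that] by auto
          ultimately show "i \<in> {..<l - 1}" using i by (simp; linarith)
        qed
        then have "S - {l + 1} \<in> sparse_sets (l - 1)"
          using S by (auto simp: sparse_sets_def)
        moreover have "S = insert (l + 1) (S - {l + 1})" using top by auto
        ultimately show ?thesis by blast
      next
        case True
        have no2: "l - 2 \<notin> S" if "l > 1"
        proof -
          have "l - 2 + 2 = l" using that by simp
          then show ?thesis using S True by (force simp: sparse_sets_def)
        qed
        have "S - {l, l + 1} \<subseteq> {..<l - 2}"
        proof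
          fix i assume i: "i \<in> S - {l, l + 1}"
          then have "i < l + 2" using S by (auto simp: sparse_sets_def)
          moreover have "i \<noteq> l - 1" if "l > 0" using i no[OF that] by auto
          moreover have "i \<noteq> l - 2" if "l > 1" using i no2[OF that] by auto
          ultimately show "i \<in> {..<l - 2}" using i by (simp; linarith)
        qed
        then have "S - {l, l + 1} \<in> sparse_sets (l - 2)"
          using S by (auto simp: sparse_sets_def)
        moreover have "S = insert (l + 1) (insert l (S - {l, l + 1}))" using top True by auto
        ultimately show ?thesis by blast
      qed
    qed
  qed
next
  show "?A \<union> (?B \<union> ?C) \<subseteq> ?L"
    by (fastforce simp: sparse_sets_def)
qed

lemma matching_count_rec:
  "matching_count (l + 2) r = matching_count (l + 1) r
     + (if r \<ge> 1 then matching_count (l - 1) (r - 1) else 0)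
     + (if r \<ge> 2 then matching_count (l - 2) (r - 2) else 0)"
proof -
  define A where "A = {S \<in> sparse_sets (l + 1). card S = r}"
  \<comment> \<open>The size is fixed by an addition, so that \<open>B\<close> and \<open>C\<close>
    are empty when \<open>r\<close> is too small; the condition \<open>card S = r - 1\<close> would
    admit the empty set at \<open>r = 0\<close>.\<close>
  define B where "B = {S \<in> sparse_sets (l - 1). card S + 1 = r}"
  define C where "C = {S \<in> sparse_sets (l - 2). card S + 2 = r}"
  let ?f = "insert (l + 1)" and ?g = "\<lambda>S. insert (l + 1) (insert l S)"
  have fin: "finite A" "finite B" "finite C"
    using finite_sparse_sets by (auto simp: A_def B_def C_def)
  have notin: "i \<notin> S" if "S \<in> sparse_sets n" "n \<le> i" for i n S
    using that by (auto simp: sparse_sets_def)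
  have cf: "card (?f S) = card S + 1" if "S \<in> sparse_sets (l - 1)" for S
    using finite_sparse[OF that] notin[OF that, of "l + 1"] by simp
  have cg: "card (?g S) = card S + 2" if "S \<in> sparse_sets (l - 2)" for S
    using finite_sparse[OF that] notin[OF that, of "l + 1"] notin[OF that, of l] by simp
  have "{S \<in> sparse_sets (l + 2). card S = r} = A \<union> (?f ` B \<union> ?g ` C)"
    unfolding sparse_sets_split A_def B_def C_def using cf cg by auto
  moreover have "A \<inter> (?f ` B \<union> ?g ` C) = {}"
    using notin[of _ "l + 1" "l + 1"] by (auto simp: A_def)
  moreover have "?f ` B \<inter> ?g ` C = {}"
  proof -
    have "l \<notin> ?f S" if "S \<in> B" for S
      using that notin[of S "l - 1" l] by (auto simp: B_def)
    then show ?thesis by blast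
  qed
  moreover have "inj_on ?f B"
    using notin[of _ "l - 1" "l + 1"] by (auto simp: B_def inj_on_def insert_ident)
  moreover have "inj_on ?g C"
    using notin[of _ "l - 2" "l + 1"] notin[of _ "l - 2" l]
    by (intro inj_onI) (auto simp: C_def insert_ident)
  ultimately have "matching_count (l + 2) r = card A + card B + card C"
    using fin by (simp add: matching_count_def card_Un_disjoint card_image)
  moreover have "card B = (if r \<ge> 1 then matching_count (l - 1) (r - 1) else 0)"
    by (auto simp: B_def matching_count_def intro!: arg_cong[where f = card])
  moreover have "card C = (if r \<ge> 2 then matching_count (l - 2) (r - 2) else 0)"
    by (auto simp: C_def matching_count_def intro!: arg_cong[where f = card])
  ultimately show ?thesis by (simp add: A_def matching_count_def)
qed

section \<open>Closed form by counting tilings\<close>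

text \<open>Tilings of length \<open>n\<close> with \<open>i\<close> blocks of length 4 and \<open>j - i\<close> of length 3. Such a tiling has
  \<open>n - 2 * j - i\<close> blocks altogether; if this subtraction truncates, the value is still 0.\<close>
definition block_count :: "nat \<Rightarrow> nat \<Rightarrow> nat \<Rightarrow> nat" where
  "block_count n j i = ((n - 2 * j - i) choose j) * (j choose i)"

text \<open>Pascal's rule applied twice. With \<open>B\<close> blocks before the last one, splitting
  \<open>Suc B choose Suc j\<close> separates a last block of length 1 from a longer one, and
  splitting \<open>Suc j choose i\<close> then separates length 3 from length 4.\<close>

lemma block_count_rec:
  "block_count (n + 4) (Suc j) i = block_count (n + 3) (Suc j) i + block_count (n + 1) j i
     + (if i \<ge> 1 then block_count n j (i - 1) else 0)"
proof (cases "n + 4 \<le> 2 * Suc j + i")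
  case True
  have "block_count (n + 1) j i = 0"
    using True by (cases j; cases i) (auto simp: block_count_def)
  moreover have "block_count n j (i - 1) = 0" if "i \<ge> 1"
    using True that by (cases j; cases i; cases "i - 1") (auto simp: block_count_def)
  ultimately show ?thesis using True by (auto simp: block_count_def)
next
  case False
  then obtain B where B: "n + 4 - 2 * Suc j - i = Suc B"
    by (metis Suc_diff_Suc diff_diff_left not_le)
  then have "n + 3 - 2 * Suc j - i = B" "n + 1 - 2 * j - i = B"
    "i \<ge> 1 \<Longrightarrow> n - 2 * j - (i - 1) = B"
    by auto
  with B show ?thesis
    by (cases i) (simp_all add: block_count_def algebra_simps)
qed

text \<open>The number of matched pairs in the tiling is \<open>i + j\<close>, and at most three
  vertices cannot carry two disjoint pairs.\<close>

lemma block_count_eq_0: "n \<le> 3 \<Longrightarrow> i + j \<ge> 2 \<Longrightarrow> block_count n j i = 0"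
  by (cases "i > j") (auto simp: block_count_def)

lemma sum_block_count_rec:
  "(\<Sum>i\<le>r. block_count (n + 4) (r - i) i) = (\<Sum>i\<le>r. block_count (n + 3) (r - i) i)
     + (if r \<ge> 1 then \<Sum>i\<le>r - 1. block_count (n + 1) (r - 1 - i) i else 0)
     + (if r \<ge> 2 then \<Sum>i\<le>r - 2. block_count n (r - 2 - i) i else 0)"
proof (cases r)
  case 0
  then show ?thesis by (simp add: block_count_def)
next
  case (Suc q)
  let ?c = "\<lambda>i. if i \<ge> 1 then block_count n (q - i) (i - 1) else 0"
  \<comment> \<open>The summand \<open>i = r\<close> has \<open>j = 0\<close>, outside the reach of
    \<open>block_count_rec\<close>, and is treated separately.\<close>
  have last: "block_count (n + 4) 0 r = block_count (n + 3) 0 r"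
    by (simp add: block_count_def)
  have "(\<Sum>i\<le>r. block_count (n + 4) (r - i) i)
      = (\<Sum>i\<le>q. block_count (n + 4) (Suc (q - i)) i) + block_count (n + 3) 0 r"
    using last by (simp add: Suc Suc_diff_le)
  also have "(\<Sum>i\<le>q. block_count (n + 4) (Suc (q - i)) i) = (\<Sum>i\<le>q. block_count (n + 3) (Suc (q - i)) i)
      + (\<Sum>i\<le>q. block_count (n + 1) (q - i) i) + (\<Sum>i\<le>q. ?c i)"
    by (simp only: block_count_rec sum.distrib)
  \<comment> \<open>The summand \<open>i = 0\<close> of \<open>?c\<close> is zero, so the index
    shifts down by one.\<close>
  also have "(\<Sum>i\<le>q. ?c i) = (if q \<ge> 1 then \<Sum>i\<le>q - 1. block_count n (q - 1 - i) i else 0)"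
    by (cases q) (simp_all add: sum.atMost_Suc_shift del: sum.atMost_Suc)
  finally show ?thesis
    by (simp add: Suc Suc_diff_le numeral_2_eq_2)
qed

lemma matching_count_0: "matching_count 0 r = (if r = 0 then 1 else 0)"
proof -
  have eq: "sparse_sets 0 = {{}}" by (auto simp: sparse_sets_def)
  have "{S \<in> sparse_sets 0. card S = r} = (if r = 0 then {{}} else {})"
    unfolding eq by (cases "r = 0") auto
  then show ?thesis by (simp add: matching_count_def)
qed

lemma matching_count_1: "matching_count 1 r = (if r = 0 \<or> r = 1 then 1 else 0)"
proof -
  have eq: "sparse_sets 1 = {{}, {0}}" by (auto simp: sparse_sets_def)
  have "{S \<in> sparse_sets 1. card S = r} = (if r = 0 then {{}} else if r = 1 then {{0}} else {})"
    unfolding eq by (cases "r = 0"; cases "r = 1") (force+)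
  then show ?thesis by (simp add: matching_count_def)
qed

text \<open>Both sides obey the same recurrence, which reaches back to \<open>n - 4\<close>; hence
  the lengths up to 3 are checked directly. There \<open>n - 2\<close> may truncate to 0, and the
  only nonempty matching is the single pair at \<open>n = 3\<close>.\<close>

lemma matching_count_eq: "matching_count (n - 2) r = (\<Sum>i\<le>r. block_count n (r - i) i)"
proof (induction n arbitrary: r rule: less_induct)
  case (less n)
  show ?case
  proof (cases "n \<le> 3")
    case True
    have count: "matching_count (n - 2) r = (if r = 0 \<or> r = 1 \<and> n = 3 then 1 else 0)"
    proof (cases "n = 3")
      case True
      then have "n - 2 = 1" by simp
      then have "matching_count (n - 2) r = matching_count 1 r" by (rule arg_cong)
      then show ?thesis unfolding matching_count_1 using True by metis
    next
      case False
      then have "n - 2 = 0" using \<open>n \<le> 3\<close> by simp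
      then have "matching_count (n - 2) r = matching_count 0 r" by (rule arg_cong)
      then show ?thesis unfolding matching_count_0 using False by metis
    qed
    consider "r = 0" | "r = 1" | "r \<ge> 2" by linarith
    then show ?thesis
    proof cases
      case 2
      then show ?thesis using count True by (auto simp: block_count_def split: if_splits)
    next
      case 3
      then show ?thesis using count True by (simp add: block_count_eq_0)
    next
      case 1
      then show ?thesis using count by (simp add: block_count_def)
    qed
  next
    case False
    then have "n = (n - 4) + 4" by simp
    then obtain k where k: "n = k + 4" by blast
    have "matching_count (n - 2) r = matching_count (k + 2) r" by (simp add: k)
    \<comment> \<open>Each index is rewritten as a vertex number minus 2, the shape of the induction
      hypothesis.\<close>
    also have "\<dots> = matching_count (k + 3 - 2) r
       + (if r \<ge> 1 then matching_count (k + 1 - 2) (r - 1) else 0)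
       + (if r \<ge> 2 then matching_count (k - 2) (r - 2) else 0)"
      by (subst matching_count_rec) (simp add: numeral_3_eq_3)
    also have "\<dots> = (\<Sum>i\<le>r. block_count n (r - i) i)"
      using k by (simp only: less.IH sum_block_count_rec)
    finally show ?thesis .
  qed
qed

section \<open>Expansion of the hafnian over sets of pairs at distance 2\<close>

definition edge :: "nat \<Rightarrow> nat set" where
  "edge i = {i, i + 2}"

lemma inj_edge: "inj edge"
  by (auto simp: inj_def edge_def doubleton_eq_iff)

lemma card_edge [simp]: "card (edge i) = 2"
  by (simp add: edge_def)

text \<open>The entry is put in the form of a sum so that a product of entries can be expanded. A
  two-element \<open>e\<close> never meets the zero diagonal.\<close>

lemma C_mat_entry:
  assumes "card e = 2" "e \<subseteq> {0..<n}"
  shows "C_mat n a b $$ (Min e, Max e) = (if e \<in> edge ` {..<n - 2} then a - b else 0) + b"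
proof -
  from assms(1) obtain u v where "e = {u, v}" "u \<noteq> v" by (auto simp: card_2_iff)
  then obtain x y where e: "e = {x, y}" "x < y"
    by (metis insert_commute linorder_neqE_nat)
  with assms(2) have xy: "y < n" "Min e = x" "Max e = y" by auto
  have "e \<in> edge ` {..<n - 2} \<longleftrightarrow> y = x + 2"
    using e xy(1) by (auto simp: edge_def doubleton_eq_iff image_iff)
  moreover have "\<bar>int x - int y\<bar> = 2 \<longleftrightarrow> y = x + 2" using e by auto
  ultimately show ?thesis using e xy by (simp add: C_mat_def)
qed

text \<open>In the expansion, \<open>Q\<close> is the set of pairs contributing their first summand.
  A term survives only if all of \<open>Q\<close> consists of pairs at distance 2, and since
  \<open>edge\<close> is injective such a \<open>Q\<close> is named by a unique \<open>S\<close>.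
  The other \<open>m - card S\<close> pairs contribute \<open>b\<close>.\<close>

lemma prod_C_mat_entries:
  fixes a b :: "'a :: comm_ring_1"
  assumes "P \<in> pair_partitions {0..<2 * m}"
  shows "(\<Prod>e\<in>P. C_mat (2 * m) a b $$ (Min e, Max e))
    = (\<Sum>S | S \<subseteq> {..<2 * m - 2} \<and> edge ` S \<subseteq> P. (a - b) ^ card S * b ^ (m - card S))"
proof -
  let ?E = "edge ` {..<2 * m - 2}"
  have fin: "finite P"
    using assms finite_elements[of "{0..<2 * m}" P] by (auto simp: pair_partitions_def)
  have cardP: "card P = m" using card_pair_partition[OF _ assms] by simp
  have "(\<Prod>e\<in>P. C_mat (2 * m) a b $$ (Min e, Max e))
      = (\<Prod>e\<in>P. (if e \<in> ?E then a - b else 0) + b)"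
    using assms by (intro prod.cong refl C_mat_entry) (auto simp: pair_partitions_def partition_on_def)
  also have "\<dots> = (\<Sum>Q\<in>Pow P. (\<Prod>e\<in>Q. if e \<in> ?E then a - b else 0) * (\<Prod>e\<in>P - Q. b))"
    using fin by (rule prod_add)
  also have "\<dots> = (\<Sum>Q\<in>Pow P. if Q \<subseteq> ?E then (a - b) ^ card Q * b ^ (m - card Q) else 0)"
  proof (rule sum.cong[OF refl])
    fix Q assume "Q \<in> Pow P"
    then have Q: "Q \<subseteq> P" "finite Q" using fin finite_subset by auto
    have "(\<Prod>e\<in>Q. if e \<in> ?E then a - b else 0) = (if Q \<subseteq> ?E then (a - b) ^ card Q else 0)"
    proof (cases "Q \<subseteq> ?E")
      case True
      then have "(\<Prod>e\<in>Q. if e \<in> ?E then a - b else 0) = (\<Prod>e\<in>Q. a - b)"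
        by (intro prod.cong) auto
      with True show ?thesis by simp
    next
      case False
      then obtain e where "e \<in> Q" "e \<notin> ?E" by blast
      then have "(\<Prod>e\<in>Q. if e \<in> ?E then a - b else 0) = 0"
        using Q(2) by (intro prod_zero bexI[of _ e]) simp_all
      with False show ?thesis by simp
    qed
    then show "(\<Prod>e\<in>Q. if e \<in> ?E then a - b else 0) * (\<Prod>e\<in>P - Q. b)
      = (if Q \<subseteq> ?E then (a - b) ^ card Q * b ^ (m - card Q) else 0)"
      using Q cardP by (simp add: card_Diff_subset)
  qed
  also have "\<dots> = (\<Sum>Q | Q \<subseteq> P \<and> Q \<subseteq> ?E. (a - b) ^ card Q * b ^ (m - card Q))"
    using fin by (simp add: sum.If_cases Pow_def Int_def)
  also have "{Q. Q \<subseteq> P \<and> Q \<subseteq> ?E} = (`) edge ` {S. S \<subseteq> {..<2 * m - 2} \<and> edge ` S \<subseteq> P}"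
    by (auto simp: subset_image_iff)
  also have "(\<Sum>Q\<in>\<dots>. (a - b) ^ card Q * b ^ (m - card Q))
      = (\<Sum>S | S \<subseteq> {..<2 * m - 2} \<and> edge ` S \<subseteq> P. (a - b) ^ card S * b ^ (m - card S))"
    using inj_on_subset[OF inj_edge]
    by (subst sum.reindex) (auto simp: card_image inj_on_def inj_image_eq_iff[OF inj_edge])
  finally show ?thesis .
qed

text \<open>Two different pairs \<open>edge i\<close> and \<open>edge j\<close> share a vertex only
  when \<open>i\<close> and \<open>j\<close> differ by 2, which sparseness forbids.\<close>

lemma sparse_edges:
  assumes "S \<in> sparse_sets (2 * m - 2)"
  shows "disjoint (edge ` S)" "\<Union>(edge ` S) \<subseteq> {0..<2 * m}" "card (\<Union>(edge ` S)) = 2 * card S"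
proof -
  show dis: "disjoint (edge ` S)"
    using assms by (auto simp: pairwise_def disjnt_def edge_def sparse_sets_def)
  show "\<Union>(edge ` S) \<subseteq> {0..<2 * m}"
    using assms by (fastforce simp: edge_def sparse_sets_def)
  have "card (\<Union>(edge ` S)) = sum card (edge ` S)"
    using dis by (intro card_Union_disjoint) (auto simp: edge_def)
  also have "\<dots> = 2 * card S"
    by (subst sum.reindex) (simp_all add: inj_on_subset[OF inj_edge])
  finally show "card (\<Union>(edge ` S)) = 2 * card S" .
qed

lemma card_sparse_le:
  assumes "S \<in> sparse_sets (2 * m - 2)"
  shows "card S \<le> m"
  using card_mono[OF _ sparse_edges(2)[OF assms]] sparse_edges(3)[OF assms] by simp

text \<open>For sparse \<open>S\<close>, the pairs named by \<open>S\<close> leave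
  \<open>2 * (m - card S)\<close> vertices to pair off freely. Otherwise two of these pairs share a
  vertex \<open>i + 2\<close>, and no partition contains both.\<close>

lemma card_pair_partitions_edges:
  assumes "S \<subseteq> {..<2 * m - 2}"
  shows "card {P \<in> pair_partitions {0..<2 * m}. edge ` S \<subseteq> P} = (if S \<in> sparse_sets (2 * m - 2)
     then fact (2 * (m - card S)) div (fact (m - card S) * 2 ^ (m - card S)) else 0)"
proof (cases "S \<in> sparse_sets (2 * m - 2)")
  case True
  have "card ({0..<2 * m} - \<Union>(edge ` S)) = 2 * (m - card S)"
    using sparse_edges[OF True]
    by (subst card_Diff_subset) (auto intro: finite_subset simp: algebra_simps)
  then show ?thesis
    using True sparse_edges[OF True]
    by (subst card_pair_partitions_superset) (auto simp: card_pair_partitions)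
next
  case False
  then obtain i where i: "i \<in> S" "i + 2 \<in> S" using assms by (auto simp: sparse_sets_def)
  have "\<not> disjoint P" if "edge ` S \<subseteq> P" for P
    using pairwiseD[of disjnt P "edge i" "edge (i + 2)"] that i
    by (auto simp: disjnt_def edge_def doubleton_eq_iff)
  then have "{P \<in> pair_partitions {0..<2 * m}. edge ` S \<subseteq> P} = {}"
    by (auto simp: pair_partitions_def partition_on_def)
  then show ?thesis using False by (simp only: card.empty if_False)
qed

lemma hafnian_C_mat:
  fixes a b :: "'a :: comm_ring_1"
  shows "hafnian (C_mat (2 * m) a b) = (\<Sum>r\<le>m. (a - b) ^ r * b ^ (m - r)
    * of_nat (fact (2 * (m - r)) div (fact (m - r) * 2 ^ (m - r))) * of_nat (matching_count (2 * m - 2) r))"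
proof -
  let ?PP = "pair_partitions {0..<2 * m}"
  let ?w = "\<lambda>r. (a - b) ^ r * b ^ (m - r)"
  let ?d = "\<lambda>r. of_nat (fact (2 * (m - r)) div (fact (m - r) * 2 ^ (m - r))) :: 'a"
  let ?L = "sparse_sets (2 * m - 2)"
  have "hafnian (C_mat (2 * m) a b)
      = (\<Sum>P\<in>?PP. \<Prod>e\<in>P. C_mat (2 * m) a b $$ (Min e, Max e))"
    by (simp add: hafnian_def C_mat_def)
  also have "\<dots> = (\<Sum>P\<in>?PP. \<Sum>S | S \<in> Pow {..<2 * m - 2} \<and> edge ` S \<subseteq> P. ?w (card S))"
    by (intro sum.cong refl) (simp add: prod_C_mat_entries)
  \<comment> \<open>After the interchange the inner summand does not depend on \<open>P\<close>, so
    only the number of partitions containing the prescribed pairs matters; the terms are then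
    grouped by \<open>card S\<close>.\<close>
  also have "\<dots> = (\<Sum>S\<in>Pow {..<2 * m - 2}. \<Sum>P | P \<in> ?PP \<and> edge ` S \<subseteq> P. ?w (card S))"
    by (rule sum.swap_restrict) (simp_all add: finite_pair_partitions)
  also have "\<dots> = (\<Sum>S\<in>Pow {..<2 * m - 2}. if S \<in> ?L then ?w (card S) * ?d (card S) else 0)"
    by (intro sum.cong refl) (simp add: card_pair_partitions_edges mult.commute[of "of_nat _"])
  also have "\<dots> = (\<Sum>S\<in>?L. ?w (card S) * ?d (card S))"
    by (subst sum.inter_restrict[symmetric]) (auto simp: sparse_sets_def intro!: sum.cong)
  also have "\<dots> = (\<Sum>r\<le>m. \<Sum>S | S \<in> ?L \<and> card S = r. ?w (card S) * ?d (card S))"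
    by (rule sum.group[symmetric]) (auto simp: finite_sparse_sets card_sparse_le)
  also have "\<dots> = (\<Sum>r\<le>m. ?w r * ?d r * of_nat (matching_count (2 * m - 2) r))"
    by (intro sum.cong refl) (simp add: matching_count_def mult.commute)
  finally show ?thesis .
qed

section \<open>Summation ranges of the final formula\<close>

text \<open>The stated range only discards zero terms of the sum over \<open>i \<le> m - k\<close>.
  Below it, \<open>2 * k + i < m - k - i\<close> annihilates the first binomial; above it,
  \<open>m - k - i < i\<close> annihilates the second.\<close>

lemma matching_count_bounds:
  assumes "k \<le> m"
  shows "matching_count (2 * m - 2) (m - k) =
    (\<Sum>i = nat (max 0 \<lceil>(real m - 3 * real k) / 2\<rceil>)..nat \<lfloor>(real m - real k) / 2\<rfloor>.
         ((2 * k + i) choose (m - k - i)) * ((m - k - i) choose i))"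
proof -
  have "matching_count (2 * m - 2) (m - k)
      = (\<Sum>i\<le>m - k. ((2 * k + i) choose (m - k - i)) * ((m - k - i) choose i))"
    unfolding matching_count_eq block_count_def
  proof (intro sum.cong refl)
    fix i assume "i \<in> {..m - k}"
    then have "2 * m - 2 * (m - k - i) - i = 2 * k + i" using assms by auto
    then show "(2 * m - 2 * (m - k - i) - i choose (m - k - i)) * (m - k - i choose i)
      = (2 * k + i choose (m - k - i)) * (m - k - i choose i)" by simp
  qed
  also have "\<dots> = (\<Sum>i = nat (max 0 \<lceil>(real m - 3 * real k) / 2\<rceil>)..nat \<lfloor>(real m - real k) / 2\<rfloor>.
         ((2 * k + i) choose (m - k - i)) * ((m - k - i) choose i))"
  proof (rule sum.mono_neutral_right)
    show "{nat (max 0 \<lceil>(real m - 3 * real k) / 2\<rceil>)..nat \<lfloor>(real m - real k) / 2\<rfloor>} \<subseteq> {..m - k}"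
    proof
      fix i assume "i \<in> {nat (max 0 \<lceil>(real m - 3 * real k) / 2\<rceil>)..nat \<lfloor>(real m - real k) / 2\<rfloor>}"
      \<comment> \<open>Nonnegativity, from \<open>k \<le> m\<close>, ensures that
        \<open>nat\<close> leaves the upper bound unchanged.\<close>
      moreover have "0 \<le> \<lfloor>(real m - real k) / 2\<rfloor>" using assms by simp
      ultimately have "int i \<le> \<lfloor>(real m - real k) / 2\<rfloor>" by (simp add: le_nat_iff)
      then have "real i \<le> (real m - real k) / 2" by (simp add: le_floor_iff)
      then show "i \<in> {..m - k}" using assms by auto
    qed
    show "\<forall>i\<in>{..m - k} - {nat (max 0 \<lceil>(real m - 3 * real k) / 2\<rceil>)..nat \<lfloor>(real m - real k) / 2\<rfloor>}.
       (2 * k + i choose (m - k - i)) * (m - k - i choose i) = 0"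
    proof
      fix i assume i: "i \<in> {..m - k} - {nat (max 0 \<lceil>(real m - 3 * real k) / 2\<rceil>)..nat \<lfloor>(real m - real k) / 2\<rfloor>}"
      then have "int i < \<lceil>(real m - 3 * real k) / 2\<rceil> \<or> \<lfloor>(real m - real k) / 2\<rfloor> < int i"
        by (auto simp: nat_le_iff le_nat_iff not_le)
      then have "real i < (real m - 3 * real k) / 2 \<or> (real m - real k) / 2 < real i"
        by (simp add: less_ceiling_iff floor_less_iff)
      then have "2 * i + 3 * k < m \<or> m < 2 * i + k"
        by (auto simp: field_simps simp flip: of_nat_less_iff[where 'a = real])
      then have "2 * k + i < m - k - i \<or> m - k - i < i" using i by (auto; arith)
      then show "(2 * k + i choose (m - k - i)) * (m - k - i choose i) = 0" by auto
    qed
  qed simp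
  finally show ?thesis .
qed

text \<open>A matching of all \<open>2 * m\<close> vertices has only blocks of length 4, so
  \<open>m\<close> would be even. In the formula, a nonzero term needs both
  \<open>m - i \<le> i\<close> and \<open>i \<le> m - i\<close>, that is
  \<open>2 * i = m\<close>.\<close>

lemma matching_count_perfect:
  assumes "odd m"
  shows "matching_count (2 * m - 2) m = 0"
proof -
  have "block_count (2 * m) (m - i) i = 0" if "i \<le> m" for i
  proof -
    have "2 * m - 2 * (m - i) - i = i" using that by auto
    moreover have "i < m - i \<or> m - i < i" using assms by (cases "2 * i = m") auto
    ultimately show ?thesis by (auto simp: block_count_def)
  qed
  then show ?thesis by (simp add: matching_count_eq)
qed

theorem theorem1:
  fixes a b :: "'a :: comm_ring_1" and m :: nat
  assumes "m > 0"
  shows "hafnian (C_mat (2 * m) a b) =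
    (\<Sum>k = (if even m then 0 else 1)..m.
       (a - b) ^ (m - k) * b ^ k * of_nat (fact (2 * k) div (fact k * 2 ^ k)) *
       of_nat (\<Sum>i = nat (max 0 \<lceil>(real m - 3 * real k) / 2\<rceil>)..nat \<lfloor>(real m - real k) / 2\<rfloor>.
         ((2 * k + i) choose (m - k - i)) * ((m - k - i) choose i)))"
proof -
  let ?t = "\<lambda>k. (a - b) ^ (m - k) * b ^ k * of_nat (fact (2 * k) div (fact k * 2 ^ k)) *
       of_nat (matching_count (2 * m - 2) (m - k))"
  have "hafnian (C_mat (2 * m) a b) = (\<Sum>k\<le>m. ?t k)"
    unfolding hafnian_C_mat
    by (rule sum.reindex_bij_witness[of _ "\<lambda>k. m - k" "\<lambda>k. m - k"]) auto
  \<comment> \<open>For odd \<open>m\<close> the dropped term \<open>k = 0\<close> counts perfect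
    matchings by pairs at distance 2, and there are none.\<close>
  also have "\<dots> = (\<Sum>k = (if even m then 0 else 1)..m. ?t k)"
  proof (rule sum.mono_neutral_right)
    show "\<forall>k\<in>{..m} - {(if even m then 0 else 1)..m}. ?t k = 0"
      using matching_count_perfect[of m] by (auto simp: Suc_le_eq split: if_splits)
  qed auto
  also have "\<dots> = (\<Sum>k = (if even m then 0 else 1)..m.
       (a - b) ^ (m - k) * b ^ k * of_nat (fact (2 * k) div (fact k * 2 ^ k)) *
       of_nat (\<Sum>i = nat (max 0 \<lceil>(real m - 3 * real k) / 2\<rceil>)..nat \<lfloor>(real m - real k) / 2\<rfloor>.
         ((2 * k + i) choose (m - k - i)) * ((m - k - i) choose i)))"
    by (intro sum.cong refl) (simp only: matching_count_bounds atLeastAtMost_iff)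
  finally show ?thesis .
qed

end
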